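(* Let $\alpha>1$, $\sigma>0$, $T>0$. Let $b:[0,+\infty)\to\mathbb{R}$ be $2(\alpha-1)$-locally Lipschitz continuous with $b(0)\ge0$, and suppose there are constants $B_1,B_2\ge0$ such that $b(y)\le B_1y-B_2y^{2\alpha-1}+b(0)$ for all $y\ge0$. For $x>0$ let $\overline{X}$ be the continuous-time exponential-Euler scheme started from $x$ with time step $\Delta t=T/N$, $N\ge1$. Then for every exponent $p$ with $0<2p\le 1+\frac{2B_2}{\sigma^2}$ there exists a non-negative constant $C_p$, depending on $p$ (and possibly on $T$ and the model parameters) but not on $x$ nor on $\Delta t$, such that $$\sup_{t\in[0,T]}\mathbb{E}\left[\overline{X}_t^{2p}\right]\le C_p(1+x^{2p}),\qquad x>0.$$
   Context: $(W_t)_{0\le t\le T}$ is a standard one-dimensional Brownian motion on a probability space $(\Omega,\mathcal{F},\mathbb{P})$ with its natural filtration. $b$ is $\gamma$-locally Lipschitz ($\gamma\ge0$) if there is $C\ge0$ such that $|b(y)-b(z)|\le C(1+|y|^{\gamma}+|z|^{\gamma})|y-z|$ for all $y,z\in[0,+\infty)$. Exponential-Euler scheme (for the SDE $dX_t=b(X_t)dt+\sigma X_t^\alpha dW_t$, $X_0=x$): let $t_n=n\Delta t$, $n=0,\dots,N$, with $\Delta t=T/N$. Set $\overline{X}_0=x$ and, for $t\in[t_n,t_{n+1}]$, $$\overline{X}_t=b(0)(t-t_n)+\overline{X}_{t_n}\exp\left\{\sigma\overline{X}_{t_n}^{\alpha-1}(W_t-W_{t_n})+\left(\frac{b(\overline{X}_{t_n})-b(0)}{\overline{X}_{t_n}}-\frac{\sigma^2}{2}\overline{X}_{t_n}^{2(\alpha-1)}\right)(t-t_n)\right\}.$$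 This process is strictly positive. *)

theory Defs
  imports "HOL-Probability.Probability"
begin

definition natural_filtration :: "'a measure \<Rightarrow> (real \<Rightarrow> 'a \<Rightarrow> real) \<Rightarrow> real \<Rightarrow> 'a measure" where
  "natural_filtration M W t =
     sigma (space M) {W s -` A \<inter> space M | s A. s \<in> {0..t} \<and> A \<in> sets borel}"

locale standard_brownian_motion = prob_space M
  for M :: "'a measure" +
  fixes T :: real and W :: "real \<Rightarrow> 'a \<Rightarrow> real"
  assumes random_variable: "\<And>t. t \<in> {0..T} \<Longrightarrow> random_variable borel (W t)"
    and start_zero: "AE \<omega> in M. W 0 \<omega> = 0"
    and continuous_paths: "AE \<omega> in M. continuous_on {0..T} (\<lambda>t. W t \<omega>)"
    and gaussian_increments: "\<And>s t. \<lbrakk>0 \<le> s; s < t; t \<le> T\<rbrakk> \<Longrightarrow>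
          distributed M lborel (\<lambda>\<omega>. W t \<omega> - W s \<omega>) (normal_density 0 (sqrt (t - s)))"
    and indep_increments: "\<And>s t. \<lbrakk>0 \<le> s; s < t; t \<le> T\<rbrakk> \<Longrightarrow>
          indep_set (sets (natural_filtration M W s))
            (sets (vimage_algebra (space M) (\<lambda>\<omega>. W t \<omega> - W s \<omega>) borel))"

text \<open>A function on \<open>[0, \<infinity>)\<close> is a total function on the reals of which only
  the values on \<open>{0..}\<close> matter. For \<open>\<gamma> = 0\<close> the convention \<open>0 powr 0 = 0\<close>
  only affects the size of \<open>C\<close>.\<close>

definition locally_Lipschitz :: "real \<Rightarrow> (real \<Rightarrow> real) \<Rightarrow> bool" where
  "locally_Lipschitz \<gamma> b \<longleftrightarrow>
     (\<exists>C\<ge>0. \<forall>y\<ge>0. \<forall>z\<ge>0. \<bar>b y - b z\<bar> \<le> C * (1 + \<bar>y\<bar> powr \<gamma> + \<bar>z\<bar> powr \<gamma>) * \<bar>y - z\<bar>)"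

text \<open>One step of the scheme from the state \<open>y\<close>, over an elapsed time \<open>h\<close> and with Brownian
  increment \<open>w\<close>.\<close>

definition exp_euler_step ::
  "(real \<Rightarrow> real) \<Rightarrow> real \<Rightarrow> real \<Rightarrow> real \<Rightarrow> real \<Rightarrow> real \<Rightarrow> real" where
  "exp_euler_step b \<sigma> \<alpha> y h w =
     b 0 * h + y * exp (\<sigma> * y powr (\<alpha> - 1) * w
       + ((b y - b 0) / y - \<sigma>\<^sup>2 / 2 * y powr (2 * (\<alpha> - 1))) * h)"

text \<open>The values of the scheme at the grid points \<open>n * \<Delta>\<close>, along a path \<open>w\<close>.\<close>

primrec exp_euler_grid ::
  "(real \<Rightarrow> real) \<Rightarrow> real \<Rightarrow> real \<Rightarrow> real \<Rightarrow> real \<Rightarrow> (real \<Rightarrow> real) \<Rightarrow> nat \<Rightarrow> real" where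
  "exp_euler_grid b \<sigma> \<alpha> x \<Delta> w 0 = x"
| "exp_euler_grid b \<sigma> \<alpha> x \<Delta> w (Suc n) =
     exp_euler_step b \<sigma> \<alpha> (exp_euler_grid b \<sigma> \<alpha> x \<Delta> w n) \<Delta>
       (w (real (Suc n) * \<Delta>) - w (real n * \<Delta>))"

text \<open>In continuous time, \<open>n\<close> is the index of the last grid point not after \<open>t\<close>. The lemmas
  \<open>exp_euler_0\<close> and \<open>exp_euler_interval\<close> below are the usual defining equations of the scheme on
  the closed intervals between consecutive grid points.\<close>

definition exp_euler ::
  "(real \<Rightarrow> real) \<Rightarrow> real \<Rightarrow> real \<Rightarrow> real \<Rightarrow> real \<Rightarrow> (real \<Rightarrow> 'a \<Rightarrow> real) \<Rightarrow> real \<Rightarrow> 'a \<Rightarrow> real" where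
  "exp_euler b \<sigma> \<alpha> x \<Delta> W t \<omega> =
     (let n = nat \<lfloor>t / \<Delta>\<rfloor> in
        exp_euler_step b \<sigma> \<alpha> (exp_euler_grid b \<sigma> \<alpha> x \<Delta> (\<lambda>s. W s \<omega>) n)
          (t - real n * \<Delta>) (W t \<omega> - W (real n * \<Delta>) \<omega>))"

lemma exp_euler_step_0 [simp]: "exp_euler_step b \<sigma> \<alpha> y 0 0 = y"
  by (simp add: exp_euler_step_def)

lemma exp_euler_grid_point:
  assumes "\<Delta> > 0"
  shows "exp_euler b \<sigma> \<alpha> x \<Delta> W (real n * \<Delta>) \<omega> = exp_euler_grid b \<sigma> \<alpha> x \<Delta> (\<lambda>s. W s \<omega>) n"
  using assms by (simp add: exp_euler_def)

lemma exp_euler_0: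
  assumes "\<Delta> > 0"
  shows "exp_euler b \<sigma> \<alpha> x \<Delta> W 0 \<omega> = x"
  using exp_euler_grid_point[OF assms, where n = 0] by simp

lemma exp_euler_interval:
  fixes W :: "real \<Rightarrow> 'a \<Rightarrow> real" and b :: "real \<Rightarrow> real" and x \<Delta> \<sigma> \<alpha> :: real and \<omega> :: 'a
  assumes "\<Delta> > 0" and "t \<in> {real n * \<Delta>..real (Suc n) * \<Delta>}"
  defines "Y \<equiv> exp_euler b \<sigma> \<alpha> x \<Delta> W (real n * \<Delta>) \<omega>"
  shows "exp_euler b \<sigma> \<alpha> x \<Delta> W t \<omega> =
    b 0 * (t - real n * \<Delta>) + Y * exp (\<sigma> * Y powr (\<alpha> - 1) * (W t \<omega> - W (real n * \<Delta>) \<omega>)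
      + ((b Y - b 0) / Y - \<sigma>\<^sup>2 / 2 * Y powr (2 * (\<alpha> - 1))) * (t - real n * \<Delta>))"
proof (cases "t = real (Suc n) * \<Delta>")
  case True
  have "real (Suc n) * \<Delta> - real n * \<Delta> = \<Delta>"
    by (simp add: algebra_simps)
  then show ?thesis
    unfolding True Y_def exp_euler_grid_point[OF assms(1)] exp_euler_grid.simps exp_euler_step_def
    by simp
next
  case False
  then have "\<lfloor>t / \<Delta>\<rfloor> = int n"
    using assms(1,2) by (intro floor_unique) (auto simp: field_simps)
  then show ?thesis
    unfolding Y_def exp_euler_grid_point[OF assms(1)]
    by (simp add: exp_euler_def exp_euler_step_def)
qed

lemma exp_euler_step_pos:
  assumes "b 0 \<ge> 0" "y > 0" "h \<ge> 0"
  shows "exp_euler_step b \<sigma> \<alpha> y h w > 0"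
  unfolding exp_euler_step_def using assms by (intro add_nonneg_pos) auto

lemma exp_euler_pos:
  assumes "b 0 \<ge> 0" "x > 0" "\<Delta> > 0" "t \<ge> 0"
  shows "exp_euler b \<sigma> \<alpha> x \<Delta> W t \<omega> > 0"
proof -
  have grid: "exp_euler_grid b \<sigma> \<alpha> x \<Delta> w n > 0" for w n
    using assms by (induction n) (auto intro: exp_euler_step_pos)
  have "real (nat \<lfloor>t / \<Delta>\<rfloor>) \<le> t / \<Delta>"
    using assms by (intro of_nat_floor) simp
  then have "real (nat \<lfloor>t / \<Delta>\<rfloor>) * \<Delta> \<le> t"
    unfolding pos_le_divide_eq[OF assms(3)] .
  then show ?thesis
    unfolding exp_euler_def Let_def using assms grid by (intro exp_euler_step_pos) auto
qed

end

theory Submission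
  imports Defs
begin

text \<open>Write \<open>q = 2 * p\<close>. Conditionally on the state \<open>y\<close> at the last grid point, the
  exponential factor of the scheme is log-normal, and the \<open>q\<close>-th moment of the
  multiplicative part over a time \<open>h\<close> is at most
  \<open>y powr q * exp (q * B\<^sub>1 * h + (q / 2) * ((q - 1) * \<sigma>\<^sup>2 - 2 * B\<^sub>2) * y powr (2 * (\<alpha> - 1)) * h)\<close>.
  The condition on \<open>p\<close> makes the superlinear term nonpositive. For \<open>q \<ge> 1\<close>, convexity of the power
  absorbs the additive part \<open>b 0 * h\<close> at the cost of a factor \<open>exp ((q - 1) * h)\<close> and a summand of
  order \<open>h\<close>, so that the bounds propagate along the grid with constants depending only on \<open>T\<close>.
  For \<open>q < 1\<close> that summand would be of order \<open>h powr q\<close>, and the number of steps times it is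
  unbounded; there the case \<open>q = 1\<close> and Jensen's inequality give the bound.\<close>

section \<open>Moment bound for a single step\<close>

text \<open>\<open>a * h + z\<close> is the convex combination of \<open>(1 + h) * a\<close> and
  \<open>(1 + h) * z\<close> with weights \<open>h / (1 + h)\<close> and \<open>1 / (1 + h)\<close>.
  Convexity leaves the factor \<open>(1 + h) powr (q - 1)\<close>, at most
  \<open>exp ((q - 1) * h)\<close>, and only the first power of \<open>h\<close> in front of
  \<open>a powr q\<close>.\<close>

lemma powr_add_mult_le:
  fixes a z h q :: real
  assumes "q \<ge> 1" "a \<ge> 0" "z > 0" "h \<ge> 0"
  shows "(a * h + z) powr q \<le> exp ((q - 1) * h) * (h * a powr q + z powr q)"
\<comment> \<open>Convexity will be used at positive points only, which \<open>a = 0\<close> would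
  violate; in both degenerate cases the base is just \<open>z\<close>.\<close>
proof (cases "a = 0 \<or> h = 0")
  case True
  have "z powr q * 1 \<le> z powr q * exp ((q - 1) * h)"
    using assms by (intro mult_left_mono) auto
  then show ?thesis
    using True by (auto simp: mult.commute)
next
  case False
  then have pos: "a > 0" "h > 0" using assms by auto
  have conv: "(u * x + v * y) powr q \<le> u * x powr q + v * y powr q"
    if "x > 0" "y > 0" "u \<ge> 0" "v \<ge> 0" "u + v = 1" for u v x y :: real
    using powr_convex[OF assms(1)] that unfolding convex_on_def by simp
  have scale: "((1 + h) * w) powr q = (1 + h) * ((1 + h) powr (q - 1) * w powr q)" if "w > 0" for w
    using that pos powr_mult_base[of "1 + h" "q - 1"] by (simp add: powr_mult)
  have "(a * h + z) powr q = (h / (1 + h) * ((1 + h) * a) + 1 / (1 + h) * ((1 + h) * z)) powr q"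
    using pos by (simp add: mult.commute)
  also have "\<dots> \<le> h / (1 + h) * ((1 + h) * a) powr q + 1 / (1 + h) * ((1 + h) * z) powr q"
    using pos assms by (intro conv) (auto simp flip: add_divide_distrib)
  also have "\<dots> = (1 + h) powr (q - 1) * (h * a powr q + z powr q)"
    using pos assms by (simp add: scale distrib_left mult.left_commute)
  also have "\<dots> \<le> exp ((q - 1) * h) * (h * a powr q + z powr q)"
  proof (intro mult_right_mono)
    have "(1 + h) powr (q - 1) \<le> exp h powr (q - 1)"
      using pos assms by (intro powr_mono2) auto
    then show "(1 + h) powr (q - 1) \<le> exp ((q - 1) * h)"
      by (simp add: powr_def)
  qed (use pos in auto)
  finally show ?thesis .
qed

text \<open>Completing the square: exponential tilting shifts the mean of a centred Gaussian to
  \<open>c * s\<^sup>2\<close> and keeps its variance.\<close>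

lemma normal_density_times_exp:
  assumes "s > 0"
  shows "normal_density 0 s w * exp (c * w) = exp (c\<^sup>2 * s\<^sup>2 / 2) * normal_density (c * s\<^sup>2) s w"
proof -
  have "- (w - 0)\<^sup>2 / (2 * s\<^sup>2) + c * w = c\<^sup>2 * s\<^sup>2 / 2 + - (w - c * s\<^sup>2)\<^sup>2 / (2 * s\<^sup>2)"
    using assms by (simp add: field_simps power2_eq_square)
  then show ?thesis
    unfolding normal_density_def
    by (metis (no_types, lifting) exp_add mult.assoc mult.left_commute)
qed

lemma nn_integral_normal_density:
  assumes "s > 0"
  shows "(\<integral>\<^sup>+w. ennreal (normal_density \<mu> s w) \<partial>lborel) = 1"
  using assms by (subst nn_integral_eq_integral) auto

text \<open>The Gaussian moment generating function: the shifted density left after tilting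
  integrates to one.\<close>

lemma nn_integral_normal_density_exp:
  assumes "s > 0"
  shows "(\<integral>\<^sup>+w. ennreal (normal_density 0 s w * exp (c * w)) \<partial>lborel) = ennreal (exp (c\<^sup>2 * s\<^sup>2 / 2))"
  unfolding normal_density_times_exp[OF assms]
  using assms by (simp add: ennreal_mult nn_integral_cmult nn_integral_normal_density)

text \<open>Convexity splits off \<open>b 0 * h\<close>; the other part is log-normal, with an
  explicit moment whose superlinear terms in the exponent have a nonpositive sum. In the resulting
  rate, \<open>q - 1\<close> is the price of convexity and \<open>q * B\<^sub>1\<close> comes from
  the growth bound.\<close>

lemma exp_euler_step_moment:
  fixes b :: "real \<Rightarrow> real" and \<sigma> \<alpha> B\<^sub>1 B\<^sub>2 q h y :: real
  assumes "\<sigma> > 0" "b 0 \<ge> 0" "B\<^sub>1 \<ge> 0" "q \<ge> 1" "q \<le> 1 + 2 * B\<^sub>2 / \<sigma>\<^sup>2" "y > 0" "h > 0"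
    and growth: "b y \<le> B\<^sub>1 * y - B\<^sub>2 * y powr (2 * \<alpha> - 1) + b 0"
  shows "(\<integral>\<^sup>+w. ennreal (normal_density 0 (sqrt h) w * exp_euler_step b \<sigma> \<alpha> y h w powr q) \<partial>lborel)
    \<le> ennreal (exp ((q - 1 + q * B\<^sub>1) * h)) * (ennreal (h * b 0 powr q) + ennreal (y powr q))"
    (is "?L \<le> _")
proof -
  \<comment> \<open>In the exponent of the scheme, \<open>\<sigma> * u\<close> is the coefficient of
    the Brownian increment and \<open>d\<close> that of \<open>h\<close>.\<close>
  define u where "u = y powr (\<alpha> - 1)"
  define d where "d = (b y - b 0) / y - \<sigma>\<^sup>2 / 2 * u\<^sup>2"
  let ?n = "normal_density 0 (sqrt h)"
  let ?e = "exp ((q - 1) * h)"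
  let ?A = "?e * (h * b 0 powr q)" and ?B = "?e * (y powr q * exp (q * d * h))"
  have u2: "y powr (2 * (\<alpha> - 1)) = u\<^sup>2"
    unfolding u_def power2_eq_square by (simp flip: powr_add)
  have step: "exp_euler_step b \<sigma> \<alpha> y h w = b 0 * h + y * exp (\<sigma> * u * w + d * h)" for w
    unfolding exp_euler_step_def u2 d_def u_def[symmetric] by simp
  have "y powr (2 * \<alpha> - 1) = y powr 1 * y powr (2 * (\<alpha> - 1))"
    unfolding powr_add[symmetric] by simp
  then have "b y - b 0 \<le> y * (B\<^sub>1 - B\<^sub>2 * u\<^sup>2)"
    using growth assms unfolding u2 by (simp add: algebra_simps)
  then have "(b y - b 0) / y \<le> B\<^sub>1 - B\<^sub>2 * u\<^sup>2"
    using assms by (simp add: pos_divide_le_eq mult.commute)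
  \<comment> \<open>The bound on \<open>q\<close>, with the denominator cleared. It makes the
    coefficient \<open>(q - 1) * \<sigma>\<^sup>2 / 2 - B\<^sub>2\<close> of
    \<open>u\<^sup>2\<close> in the total exponent nonpositive.\<close>
  moreover have "(q - 1) * \<sigma>\<^sup>2 \<le> 2 * B\<^sub>2"
    using assms by (simp add: field_simps)
  then have "(q - 1) * \<sigma>\<^sup>2 * u\<^sup>2 \<le> 2 * B\<^sub>2 * u\<^sup>2"
    by (intro mult_right_mono) auto
  ultimately have "(q * \<sigma>\<^sup>2 * u\<^sup>2 / 2 + d) \<le> B\<^sub>1"
    unfolding d_def by (simp add: algebra_simps)
  then have "q * h * (q * \<sigma>\<^sup>2 * u\<^sup>2 / 2 + d) \<le> q * h * B\<^sub>1"
    using assms by (intro mult_left_mono) auto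
  then have exponent: "q * d * h + (q * \<sigma> * u)\<^sup>2 * h / 2 \<le> q * B\<^sub>1 * h"
    by (simp add: field_simps power2_eq_square)
  \<comment> \<open>The integrand is dominated by a multiple of the Gaussian density plus a multiple
    of a tilted one; both integrate explicitly.\<close>
  have "?n w * exp_euler_step b \<sigma> \<alpha> y h w powr q \<le> ?A * ?n w + ?B * (?n w * exp (q * \<sigma> * u * w))" for w
  proof -
    have "exp_euler_step b \<sigma> \<alpha> y h w powr q
        \<le> ?e * (h * b 0 powr q + (y * exp (\<sigma> * u * w + d * h)) powr q)"
      unfolding step using assms by (intro powr_add_mult_le) auto
    also have "(y * exp (\<sigma> * u * w + d * h)) powr q = y powr q * exp (q * d * h) * exp (q * \<sigma> * u * w)"
      using assms by (simp add: powr_mult powr_def[of "exp _"] algebra_simps flip: exp_add)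
    finally have "?n w * exp_euler_step b \<sigma> \<alpha> y h w powr q
        \<le> ?n w * (?e * (h * b 0 powr q + y powr q * exp (q * d * h) * exp (q * \<sigma> * u * w)))"
      by (intro mult_left_mono) auto
    then show ?thesis by (simp add: algebra_simps)
  qed
  then have "?L \<le> (\<integral>\<^sup>+w. ennreal ?A * ennreal (?n w)
      + ennreal ?B * ennreal (?n w * exp (q * \<sigma> * u * w)) \<partial>lborel)"
    using assms by (intro nn_integral_mono) (simp flip: ennreal_mult ennreal_plus)
  also have "\<dots> = ennreal ?A + ennreal ?B * ennreal (exp ((q * \<sigma> * u)\<^sup>2 * h / 2))"
    using assms
    by (simp add: nn_integral_add nn_integral_cmult nn_integral_normal_density nn_integral_normal_density_exp)
  also have "\<dots> = ennreal (?A + ?e * (y powr q * exp (q * d * h + (q * \<sigma> * u)\<^sup>2 * h / 2)))"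
    using assms by (simp add: exp_add algebra_simps flip: ennreal_mult ennreal_plus)
  also have "\<dots> \<le> ennreal (exp ((q - 1 + q * B\<^sub>1) * h) * (h * b 0 powr q + y powr q))"
  proof (intro ennreal_leI)
    let ?E = "exp (q * B\<^sub>1 * h)"
    \<comment> \<open>The additive term is enlarged by \<open>?E\<close>, which is at least 1, so
      that both terms share one exponential factor.\<close>
    have "h * b 0 powr q * 1 \<le> h * b 0 powr q * ?E"
      using assms by (intro mult_left_mono) auto
    have "?A + ?e * (y powr q * exp (q * d * h + (q * \<sigma> * u)\<^sup>2 * h / 2))
        \<le> ?e * (h * b 0 powr q * ?E) + ?e * (y powr q * ?E)"
      using assms exponent \<open>h * b 0 powr q * 1 \<le> h * b 0 powr q * ?E\<close>
      by (intro add_mono mult_left_mono) auto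
    also have "\<dots> = exp ((q - 1 + q * B\<^sub>1) * h) * (h * b 0 powr q + y powr q)"
      by (simp add: algebra_simps flip: exp_add)
    finally show "?A + ?e * (y powr q * exp (q * d * h + (q * \<sigma> * u)\<^sup>2 * h / 2))
      \<le> exp ((q - 1 + q * B\<^sub>1) * h) * (h * b 0 powr q + y powr q)" .
  qed
  finally show ?thesis
    using assms by (simp add: ennreal_mult ennreal_plus)
qed

section \<open>Positivity of the scheme and continuity of the drift\<close>

lemma exp_euler_grid_pos:
  assumes "b 0 \<ge> 0" "x > 0" "\<Delta> > 0"
  shows "exp_euler_grid b \<sigma> \<alpha> x \<Delta> w n > 0"
  using assms by (induction n) (auto intro: exp_euler_step_pos)

lemma floor_grid_le:
  fixes \<Delta> t :: real
  assumes "\<Delta> > 0" "t \<ge> 0"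
  shows "real (nat \<lfloor>t / \<Delta>\<rfloor>) * \<Delta> \<le> t"
  unfolding pos_le_divide_eq[OF assms(1), symmetric] using assms by (intro of_nat_floor) simp

text \<open>By positivity the scheme evaluates the drift only at zero and at positive states. Its
  values on the negative half-line can therefore be changed to make it measurable.\<close>

lemma exp_euler_cong:
  assumes "\<And>y. y \<ge> 0 \<Longrightarrow> b y = c y" "b 0 \<ge> 0" "x > 0" "\<Delta> > 0"
  shows "exp_euler b \<sigma> \<alpha> x \<Delta> W t \<omega> = exp_euler c \<sigma> \<alpha> x \<Delta> W t \<omega>"
proof -
  have step: "exp_euler_step b \<sigma> \<alpha> y h w = exp_euler_step c \<sigma> \<alpha> y h w" if "y > 0" for y h w
    using that assms(1) by (simp add: exp_euler_step_def)
  have pos: "exp_euler_grid b \<sigma> \<alpha> x \<Delta> w n > 0" for w n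
    using assms by (intro exp_euler_grid_pos)
  have "exp_euler_grid b \<sigma> \<alpha> x \<Delta> w n = exp_euler_grid c \<sigma> \<alpha> x \<Delta> w n" for w n
    by (induction n) (simp, metis exp_euler_grid.simps(2) step[OF pos])
  then show ?thesis
    unfolding exp_euler_def Let_def step[OF pos] by simp
qed

text \<open>The Lipschitz bound tends to 0 as \<open>y\<close> tends to \<open>z\<close>. Continuity
  serves to obtain a Borel measurable drift.\<close>

lemma locally_Lipschitz_continuous_on:
  assumes "locally_Lipschitz \<gamma> b" "\<gamma> > 0"
  shows "continuous_on {0..} b"
  unfolding continuous_on_def
proof
  fix z :: real assume z: "z \<in> {0..}"
  obtain C where C: "\<And>y z. y \<ge> 0 \<Longrightarrow> z \<ge> 0 \<Longrightarrow>
      \<bar>b y - b z\<bar> \<le> C * (1 + \<bar>y\<bar> powr \<gamma> + \<bar>z\<bar> powr \<gamma>) * \<bar>y - z\<bar>"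
    using assms(1) unfolding locally_Lipschitz_def by blast
  have abs: "((\<lambda>y. \<bar>y\<bar>) \<longlongrightarrow> \<bar>z\<bar>) (at z within {0..})"
    by (intro tendsto_rabs tendsto_ident_at)
  \<comment> \<open>At \<open>z = 0\<close>, convergence of the power rests on
    \<open>\<gamma> > 0\<close>.\<close>
  have powr: "((\<lambda>y. \<bar>y\<bar> powr \<gamma>) \<longlongrightarrow> \<bar>z\<bar> powr \<gamma>) (at z within {0..})"
    using assms(2) by (intro tendsto_powr'[OF abs tendsto_const]) simp
  have diff: "((\<lambda>y. \<bar>y - z\<bar>) \<longlongrightarrow> \<bar>z - z\<bar>) (at z within {0..})"
    by (intro tendsto_rabs tendsto_diff tendsto_ident_at tendsto_const)
  have "((\<lambda>y. C * (1 + \<bar>y\<bar> powr \<gamma> + \<bar>z\<bar> powr \<gamma>) * \<bar>y - z\<bar>)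
      \<longlongrightarrow> C * (1 + \<bar>z\<bar> powr \<gamma> + \<bar>z\<bar> powr \<gamma>) * \<bar>z - z\<bar>) (at z within {0..})"
    by (intro tendsto_mult tendsto_add tendsto_const powr diff)
  then have "((\<lambda>y. C * (1 + \<bar>y\<bar> powr \<gamma> + \<bar>z\<bar> powr \<gamma>) * \<bar>y - z\<bar>) \<longlongrightarrow> 0) (at z within {0..})"
    by simp
  moreover have "\<forall>\<^sub>F y in at z within {0..}. norm (b y - b z) \<le> C * (1 + \<bar>y\<bar> powr \<gamma> + \<bar>z\<bar> powr \<gamma>) * \<bar>y - z\<bar>"
    using C z by (simp add: eventually_at_filter)
  ultimately have "((\<lambda>y. b y - b z) \<longlongrightarrow> 0) (at z within {0..})"
    by (rule Lim_null_comparison[rotated])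
  then show "(b \<longlongrightarrow> b z) (at z within {0..})"
    by (rule LIM_zero_cancel)
qed

section \<open>Adaptedness and independence of the increments\<close>

context standard_brownian_motion
begin

lemma sets_natural_filtration_subset:
  assumes "0 \<le> s" "s \<le> T"
  shows "sets (natural_filtration M W s) \<subseteq> sets M"
  unfolding natural_filtration_def using assms random_variable
  by (subst sets_measure_of) (auto intro!: sets.sigma_sets_subset measurable_sets)

lemma space_natural_filtration [simp]: "space (natural_filtration M W s) = space M"
  unfolding natural_filtration_def by (rule space_measure_of) auto

lemma natural_filtration_measurable:
  assumes "u \<in> {0..s}"
  shows "W u \<in> borel_measurable (natural_filtration M W s)"
proof (rule measurableI)
  fix A :: "real set" assume "A \<in> sets borel"
  then show "W u -` A \<inter> space (natural_filtration M W s) \<in> sets (natural_filtration M W s)"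
    using assms unfolding space_natural_filtration
    unfolding natural_filtration_def
    by (subst sets_measure_of) (auto intro!: sigma_sets.Basic)
qed simp

lemma natural_filtration_measurable_mono:
  assumes "Y \<in> borel_measurable (natural_filtration M W s)" "0 \<le> s" "s \<le> T"
  shows "random_variable borel Y"
  using assms sets_natural_filtration_subset[of s]
  by (auto simp: measurable_def)

text \<open>\<open>Y\<close> is known at time \<open>s\<close>, hence independent of the increment.
  Their joint law is a product, and Tonelli's theorem freezes \<open>Y\<close> while the increment
  is integrated against its density. This takes the place of conditioning on the past.\<close>

lemma nn_integral_increment:
  fixes Y :: "'a \<Rightarrow> real" and f :: "real \<times> real \<Rightarrow> ennreal"
  assumes st: "0 \<le> s" "s < t" "t \<le> T"
    and Y: "Y \<in> borel_measurable (natural_filtration M W s)"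
    and f: "f \<in> borel_measurable (borel \<Otimes>\<^sub>M borel)"
  shows "(\<integral>\<^sup>+\<omega>. f (Y \<omega>, W t \<omega> - W s \<omega>) \<partial>M)
    = (\<integral>\<^sup>+\<omega>. (\<integral>\<^sup>+w. ennreal (normal_density 0 (sqrt (t - s)) w) * f (Y \<omega>, w) \<partial>lborel) \<partial>M)"
proof -
  let ?D = "\<lambda>\<omega>. W t \<omega> - W s \<omega>"
  have [measurable]: "random_variable borel Y"
    using natural_filtration_measurable_mono[OF Y] st by simp
  have [measurable]: "random_variable borel ?D"
    using random_variable[of t] random_variable[of s] st by simp
  \<comment> \<open>The sigma-algebra generated by \<open>Y\<close> lies in the past up to
    \<open>s\<close> and inherits its independence from the increment.\<close>
  have "indep_set (sigma_sets (space M) {Y -` A \<inter> space M |A. A \<in> sets borel})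
     (sigma_sets (space M) {?D -` A \<inter> space M |A. A \<in> sets borel})"
  proof -
    have "sigma_sets (space M) {Y -` A \<inter> space M |A. A \<in> sets borel} \<subseteq> sets (natural_filtration M W s)"
      using measurable_sets[OF Y]
      by (subst space_natural_filtration[of s, symmetric], intro sets.sigma_sets_subset) auto
    then show ?thesis
      using indep_increments[OF st] unfolding indep_sets2_eq sets_vimage_algebra by blast
  qed
  then have "indep_var borel Y borel ?D"
    unfolding indep_var_eq by simp
  then have joint: "distr M borel Y \<Otimes>\<^sub>M distr M borel ?D = distr M (borel \<Otimes>\<^sub>M borel) (\<lambda>\<omega>. (Y \<omega>, ?D \<omega>))"
    unfolding indep_var_distribution_eq by simp
  interpret D: prob_space "distr M borel ?D"
    by (rule prob_space_distr) simp
  have "(\<integral>\<^sup>+\<omega>. f (Y \<omega>, ?D \<omega>) \<partial>M) = (\<integral>\<^sup>+z. f z \<partial>(distr M borel Y \<Otimes>\<^sub>M distr M borel ?D))"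
    unfolding joint using f by (subst nn_integral_distr) auto
  also have "\<dots> = (\<integral>\<^sup>+y. (\<integral>\<^sup>+w. f (y, w) \<partial>distr M borel ?D) \<partial>distr M borel Y)"
    using f by (subst D.nn_integral_fst) (auto cong: measurable_cong_sets)
  also have "\<dots> = (\<integral>\<^sup>+\<omega>. (\<integral>\<^sup>+w. f (Y \<omega>, w) \<partial>distr M borel ?D) \<partial>M)"
    using f by (subst nn_integral_distr) (auto intro!: D.borel_measurable_nn_integral simp: case_prod_beta' cong: measurable_cong_sets)
  also have "\<dots> = (\<integral>\<^sup>+\<omega>. (\<integral>\<^sup>+\<omega>'. f (Y \<omega>, ?D \<omega>') \<partial>M) \<partial>M)"
    using f by (simp add: nn_integral_distr)
  also have "\<dots> = (\<integral>\<^sup>+\<omega>. (\<integral>\<^sup>+w. ennreal (normal_density 0 (sqrt (t - s)) w) * f (Y \<omega>, w) \<partial>lborel) \<partial>M)"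
    using distributed_nn_integral[OF gaussian_increments[OF st]] f by simp
  finally show ?thesis .
qed

text \<open>Adaptedness of the grid values. The time \<open>s\<close> may exceed
  \<open>real n * \<Delta>\<close>, so that the induction stays within one sigma-algebra.\<close>

lemma exp_euler_grid_measurable:
  assumes [measurable]: "b \<in> borel_measurable borel" and "\<Delta> > 0" "real n * \<Delta> \<le> s"
  shows "(\<lambda>\<omega>. exp_euler_grid b \<sigma> \<alpha> x \<Delta> (\<lambda>u. W u \<omega>) n) \<in> borel_measurable (natural_filtration M W s)"
  using assms(3)
proof (induction n)
  case (Suc n)
  have le: "real n * \<Delta> \<le> real (Suc n) * \<Delta>" "0 \<le> real n * \<Delta>"
    using assms(2) by auto
  have [measurable]: "W (real (Suc n) * \<Delta>) \<in> borel_measurable (natural_filtration M W s)"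
    "W (real n * \<Delta>) \<in> borel_measurable (natural_filtration M W s)"
    using Suc.prems le by (intro natural_filtration_measurable; force)+
  have [measurable]: "(\<lambda>\<omega>. exp_euler_grid b \<sigma> \<alpha> x \<Delta> (\<lambda>u. W u \<omega>) n) \<in> borel_measurable (natural_filtration M W s)"
    using Suc.IH Suc.prems le by linarith
  show ?case
    unfolding exp_euler_grid.simps exp_euler_step_def by measurable
qed simp

lemma exp_euler_measurable:
  assumes [measurable]: "b \<in> borel_measurable borel" and "\<Delta> > 0" "t \<in> {0..T}"
  shows "random_variable borel (exp_euler b \<sigma> \<alpha> x \<Delta> W t)"
proof -
  define n where "n = nat \<lfloor>t / \<Delta>\<rfloor>"
  have n: "real n * \<Delta> \<le> t" "0 \<le> real n * \<Delta>"
    using floor_grid_le[of \<Delta> t] assms by (auto simp: n_def)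
  have [measurable]: "random_variable borel (\<lambda>\<omega>. exp_euler_grid b \<sigma> \<alpha> x \<Delta> (\<lambda>u. W u \<omega>) n)"
    using natural_filtration_measurable_mono[OF exp_euler_grid_measurable[OF assms(1,2) order_refl]] n assms
    by simp
  have [measurable]: "random_variable borel (W t)" "random_variable borel (W (real n * \<Delta>))"
    using random_variable n assms by auto
  show ?thesis
    unfolding exp_euler_def Let_def n_def[symmetric] exp_euler_step_def by measurable
qed

section \<open>Propagation of the moments along the scheme\<close>

context
  fixes b :: "real \<Rightarrow> real" and \<sigma> \<alpha> B\<^sub>1 B\<^sub>2 q :: real
  assumes b [measurable]: "b \<in> borel_measurable borel"
    and params: "\<sigma> > 0" "b 0 \<ge> 0" "B\<^sub>1 \<ge> 0" "q \<ge> 1" "q \<le> 1 + 2 * B\<^sub>2 / \<sigma>\<^sup>2"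
    and growth: "\<And>y. y > 0 \<Longrightarrow> b y \<le> B\<^sub>1 * y - B\<^sub>2 * y powr (2 * \<alpha> - 1) + b 0"
begin

text \<open>With \<open>K = q - 1 + q * B\<^sub>1\<close>, the form
  \<open>exp (K * s) * (s * b 0 powr q + X)\<close> of the bound survives a step from
  \<open>s\<close> to \<open>t\<close>, which adds \<open>(t - s) * b 0 powr q\<close> and
  multiplies by \<open>exp (K * (t - s))\<close>. \<open>X\<close> stands for the initial moment.
  Free \<open>s\<close> and \<open>t\<close> cover full grid steps and the incomplete last
  one.\<close>

lemma exp_euler_step_moment_propagate:
  fixes X :: real
  assumes st: "0 \<le> s" "s \<le> t" "t \<le> T" and "X \<ge> 0"
    and Y: "Y \<in> borel_measurable (natural_filtration M W s)" and Y_pos: "\<And>\<omega>. Y \<omega> > 0"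
    and moment: "(\<integral>\<^sup>+\<omega>. ennreal (Y \<omega> powr q) \<partial>M)
      \<le> ennreal (exp ((q - 1 + q * B\<^sub>1) * s) * (s * b 0 powr q + X))"
  shows "(\<integral>\<^sup>+\<omega>. ennreal (exp_euler_step b \<sigma> \<alpha> (Y \<omega>) (t - s) (W t \<omega> - W s \<omega>) powr q) \<partial>M)
    \<le> ennreal (exp ((q - 1 + q * B\<^sub>1) * t) * (t * b 0 powr q + X))"
proof (cases "s = t")
  \<comment> \<open>This happens when the final time is a grid point. The increment then has no
    density, but the step is the identity.\<close>
  case True
  then show ?thesis using moment by simp
next
  case False
  with st have "s < t" by simp
  define K where "K = q - 1 + q * B\<^sub>1"
  have "K \<ge> 0" using params by (simp add: K_def)
  have [measurable]: "random_variable borel Y"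
    using natural_filtration_measurable_mono[OF Y] st by simp
  have "(\<integral>\<^sup>+\<omega>. ennreal (exp_euler_step b \<sigma> \<alpha> (Y \<omega>) (t - s) (W t \<omega> - W s \<omega>) powr q) \<partial>M)
      = (\<integral>\<^sup>+\<omega>. (\<integral>\<^sup>+w. ennreal (normal_density 0 (sqrt (t - s)) w)
          * ennreal (exp_euler_step b \<sigma> \<alpha> (Y \<omega>) (t - s) w powr q) \<partial>lborel) \<partial>M)"
    by (rule nn_integral_increment[OF st(1) \<open>s < t\<close> st(3) Y,
          where f = "\<lambda>(y, w). ennreal (exp_euler_step b \<sigma> \<alpha> y (t - s) w powr q)", simplified])
      (unfold exp_euler_step_def, measurable)
  also have "\<dots> \<le> (\<integral>\<^sup>+\<omega>. ennreal (exp (K * (t - s)))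
      * (ennreal ((t - s) * b 0 powr q) + ennreal (Y \<omega> powr q)) \<partial>M)"
    unfolding K_def using params Y_pos growth \<open>s < t\<close>
    by (intro nn_integral_mono)
      (simp add: exp_euler_step_moment[where B\<^sub>2 = B\<^sub>2] flip: ennreal_mult)
  also have "\<dots> = ennreal (exp (K * (t - s)))
      * (ennreal ((t - s) * b 0 powr q) + (\<integral>\<^sup>+\<omega>. ennreal (Y \<omega> powr q) \<partial>M))"
    by (simp add: nn_integral_cmult nn_integral_add emeasure_space_1)
  also have "\<dots> \<le> ennreal (exp (K * (t - s)))
      * (ennreal ((t - s) * b 0 powr q) + ennreal (exp (K * s) * (s * b 0 powr q + X)))"
    using moment unfolding K_def by (intro mult_left_mono add_left_mono) auto
  also have "\<dots> = ennreal (exp (K * (t - s)) * ((t - s) * b 0 powr q + exp (K * s) * (s * b 0 powr q + X)))"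
    using st \<open>X \<ge> 0\<close> by (simp flip: ennreal_mult ennreal_plus)
  also have "\<dots> \<le> ennreal (exp (K * t) * (t * b 0 powr q + X))"
  proof (intro ennreal_leI)
    \<comment> \<open>The new additive term can take on the factor \<open>exp (K * s)\<close> and so
      merge with the accumulated one.\<close>
    have "1 \<le> exp (K * s)" using \<open>K \<ge> 0\<close> st by simp
    then have "(t - s) * b 0 powr q * 1 \<le> (t - s) * b 0 powr q * exp (K * s)"
      using st by (intro mult_left_mono) auto
    then have "exp (K * (t - s)) * ((t - s) * b 0 powr q + exp (K * s) * (s * b 0 powr q + X))
      \<le> exp (K * (t - s)) * ((t - s) * b 0 powr q * exp (K * s) + exp (K * s) * (s * b 0 powr q + X))"
      by (intro mult_left_mono) auto
    also have "\<dots> = exp (K * (t - s)) * exp (K * s) * (t * b 0 powr q + X)"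
      by (simp add: algebra_simps)
    also have "exp (K * (t - s)) * exp (K * s) = exp (K * t)"
      by (simp add: algebra_simps flip: exp_add)
    finally show "exp (K * (t - s)) * ((t - s) * b 0 powr q + exp (K * s) * (s * b 0 powr q + X))
      \<le> exp (K * t) * (t * b 0 powr q + X)" .
  qed
  finally show ?thesis unfolding K_def .
qed

lemma exp_euler_grid_moment:
  assumes "x > 0" "\<Delta> > 0" "real n * \<Delta> \<le> T"
  shows "(\<integral>\<^sup>+\<omega>. ennreal (exp_euler_grid b \<sigma> \<alpha> x \<Delta> (\<lambda>u. W u \<omega>) n powr q) \<partial>M)
    \<le> ennreal (exp ((q - 1 + q * B\<^sub>1) * (real n * \<Delta>)) * (real n * \<Delta> * b 0 powr q + x powr q))"
  using assms(3)
proof (induction n)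
  case 0
  then show ?case by (simp add: emeasure_space_1)
next
  case (Suc n)
  have h: "\<Delta> = real (Suc n) * \<Delta> - real n * \<Delta>" by (simp add: algebra_simps)
  have le: "real n * \<Delta> \<le> real (Suc n) * \<Delta>" "0 \<le> real n * \<Delta>"
    using assms(2) by auto
  have pos: "exp_euler_grid b \<sigma> \<alpha> x \<Delta> (\<lambda>u. W u \<omega>) n > 0" for \<omega>
    using params assms by (intro exp_euler_grid_pos) auto
  have "exp_euler_grid b \<sigma> \<alpha> x \<Delta> (\<lambda>u. W u \<omega>) (Suc n) =
     exp_euler_step b \<sigma> \<alpha> (exp_euler_grid b \<sigma> \<alpha> x \<Delta> (\<lambda>u. W u \<omega>) n)
      (real (Suc n) * \<Delta> - real n * \<Delta>) (W (real (Suc n) * \<Delta>) \<omega> - W (real n * \<Delta>) \<omega>)" for \<omega>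
    unfolding exp_euler_grid.simps(2) using h by simp
  moreover have "(\<integral>\<^sup>+\<omega>. ennreal (exp_euler_step b \<sigma> \<alpha> (exp_euler_grid b \<sigma> \<alpha> x \<Delta> (\<lambda>u. W u \<omega>) n)
      (real (Suc n) * \<Delta> - real n * \<Delta>) (W (real (Suc n) * \<Delta>) \<omega> - W (real n * \<Delta>) \<omega>) powr q) \<partial>M)
    \<le> ennreal (exp ((q - 1 + q * B\<^sub>1) * (real (Suc n) * \<Delta>)) * (real (Suc n) * \<Delta> * b 0 powr q + x powr q))"
    using le Suc pos exp_euler_grid_measurable[OF b assms(2) order_refl]
    by (intro exp_euler_step_moment_propagate) auto
  ultimately show ?case by presburger
qed

text \<open>The grid bound is used at the last grid point up to \<open>t\<close>; one more
  propagation covers the remaining time \<open>t - real n * \<Delta>\<close>, possibly zero.\<close>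

lemma exp_euler_moment:
  assumes "x > 0" "\<Delta> > 0" "t \<in> {0..T}"
  shows "(\<integral>\<^sup>+\<omega>. ennreal (exp_euler b \<sigma> \<alpha> x \<Delta> W t \<omega> powr q) \<partial>M)
    \<le> ennreal (exp ((q - 1 + q * B\<^sub>1) * t) * (t * b 0 powr q + x powr q))"
proof -
  define n where "n = nat \<lfloor>t / \<Delta>\<rfloor>"
  have n: "real n * \<Delta> \<le> t" "0 \<le> real n * \<Delta>"
    using floor_grid_le[of \<Delta> t] assms by (auto simp: n_def)
  have pos: "exp_euler_grid b \<sigma> \<alpha> x \<Delta> (\<lambda>u. W u \<omega>) n > 0" for \<omega>
    using params assms by (intro exp_euler_grid_pos) auto
  show ?thesis
    unfolding exp_euler_def Let_def n_def[symmetric]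
    using n assms pos exp_euler_grid_measurable[OF b assms(2) order_refl] exp_euler_grid_moment
    by (intro exp_euler_step_moment_propagate) auto
qed

end

end

section \<open>Exponents below one\<close>

text \<open>Concavity: the power lies below its tangent at \<open>c\<close>. The tangent is affine
  in \<open>z\<close>, so that integrating it involves only the mean.\<close>

lemma powr_le_tangent:
  fixes z c q :: real
  assumes "z > 0" "c > 0" "0 \<le> q" "q \<le> 1"
  shows "z powr q \<le> c powr q * (1 - q) + q * c powr (q - 1) * z"
proof -
  \<comment> \<open>Weighted arithmetic-geometric mean inequality; multiplying by
    \<open>c powr (q - 1)\<close> then isolates \<open>z powr q\<close>.\<close>
  have "z powr q * c powr (1 - q) \<le> q * z + (1 - q) * c"
    using assms by (intro Youngs_inequality_0) auto
  then have "z powr q * c powr (1 - q) * c powr (q - 1) \<le> (q * z + (1 - q) * c) * c powr (q - 1)"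
    by (intro mult_right_mono) auto
  moreover have "c powr (1 - q) * c powr (q - 1) = 1" "c * c powr (q - 1) = c powr q"
    using assms by (auto simp: powr_mult_base simp flip: powr_add)
  ultimately have "z powr q * 1 \<le> q * z * c powr (q - 1) + (1 - q) * c powr q"
    by (simp only: distrib_right mult.assoc)
  then show ?thesis
    by (simp add: algebra_simps)
qed

text \<open>Jensen's inequality, by integrating the tangent at \<open>c\<close>. As its slope is
  nonnegative, \<open>c\<close> may be any upper bound of the mean.\<close>

lemma (in prob_space) nn_integral_powr_le:
  fixes f :: "'a \<Rightarrow> real"
  assumes "\<And>\<omega>. f \<omega> > 0" "c > 0" "0 \<le> q" "q \<le> 1"
    and [measurable]: "f \<in> borel_measurable M"
    and mean: "(\<integral>\<^sup>+\<omega>. ennreal (f \<omega>) \<partial>M) \<le> ennreal c"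
  shows "(\<integral>\<^sup>+\<omega>. ennreal (f \<omega> powr q) \<partial>M) \<le> ennreal (c powr q)"
proof -
  have "(\<integral>\<^sup>+\<omega>. ennreal (f \<omega> powr q) \<partial>M)
      \<le> (\<integral>\<^sup>+\<omega>. ennreal (c powr q * (1 - q)) + ennreal (q * c powr (q - 1)) * ennreal (f \<omega>) \<partial>M)"
    using assms powr_le_tangent[of "f _" c q]
    by (intro nn_integral_mono) (simp add: less_imp_le flip: ennreal_mult ennreal_plus)
  also have "\<dots> = ennreal (c powr q * (1 - q)) + ennreal (q * c powr (q - 1)) * (\<integral>\<^sup>+\<omega>. ennreal (f \<omega>) \<partial>M)"
    by (simp add: nn_integral_cmult nn_integral_add emeasure_space_1)
  also have "\<dots> \<le> ennreal (c powr q * (1 - q)) + ennreal (q * c powr (q - 1)) * ennreal c"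
    using mean by (intro add_left_mono mult_left_mono) auto
  also have "\<dots> = ennreal (c powr q * (1 - q) + q * (c * c powr (q - 1)))"
    using assms by (simp add: ac_simps flip: ennreal_mult ennreal_plus)
  also have "\<dots> = ennreal (c powr q)"
    using assms by (simp add: powr_mult_base algebra_simps)
  finally show ?thesis .
qed

theorem lemma3p2:
  fixes M :: "'a measure" and W :: "real \<Rightarrow> 'a \<Rightarrow> real"
    and b :: "real \<Rightarrow> real" and \<alpha> \<sigma> T B\<^sub>1 B\<^sub>2 p :: real
  assumes "\<alpha> > 1" and "\<sigma> > 0" and "T > 0"
    and "standard_brownian_motion M T W"
    and "locally_Lipschitz (2 * (\<alpha> - 1)) b"
    and "b 0 \<ge> 0"
    and "B\<^sub>1 \<ge> 0" and "B\<^sub>2 \<ge> 0"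
    and "\<And>y. y \<ge> 0 \<Longrightarrow> b y \<le> B\<^sub>1 * y - B\<^sub>2 * y powr (2 * \<alpha> - 1) + b 0"
    and "0 < 2 * p" and "2 * p \<le> 1 + 2 * B\<^sub>2 / \<sigma>\<^sup>2"
  shows "\<exists>C\<ge>0. \<forall>x>0. \<forall>N::nat. N \<ge> 1 \<longrightarrow>
    (SUP t\<in>{0..T}. \<integral>\<^sup>+ \<omega>. ennreal (exp_euler b \<sigma> \<alpha> x (T / real N) W t \<omega> powr (2 * p)) \<partial>M)
      \<le> ennreal (C * (1 + x powr (2 * p)))"
proof -
  interpret standard_brownian_motion M T W by fact
  define q where "q = 2 * p"
  have "q > 0" and q_le: "q \<le> 1 + 2 * B\<^sub>2 / \<sigma>\<^sup>2"
    using assms(10,11) by (auto simp: q_def)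
  \<comment> \<open>\<open>b\<close> may fail to be measurable on the negative half-line.\<close>
  define c where "c = (\<lambda>y. b (max 0 y))"
  have c0: "c 0 = b 0"
    by (simp add: c_def)
  have "continuous_on {0..} b"
    using locally_Lipschitz_continuous_on[OF assms(5)] assms(1) by simp
  then have "continuous_on UNIV c"
    unfolding c_def by (rule continuous_on_compose2) (auto intro!: continuous_intros)
  then have c: "c \<in> borel_measurable borel"
    by (rule borel_measurable_continuous_onI)
  have growth: "c y \<le> B\<^sub>1 * y - B\<^sub>2 * y powr (2 * \<alpha> - 1) + c 0" if "y > 0" for y
    using assms(9)[of y] that by (simp add: c_def)
  \<comment> \<open>Replacing the elapsed time by \<open>T\<close> makes the bound uniform in
    \<open>t\<close>. The exponent \<open>r\<close> is free because both \<open>r = q\<close> and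
    \<open>r = 1\<close> are used.\<close>
  have moment: "(\<integral>\<^sup>+\<omega>. ennreal (exp_euler c \<sigma> \<alpha> x \<Delta> W t \<omega> powr r) \<partial>M)
      \<le> ennreal (exp ((r - 1 + r * B\<^sub>1) * T) * (T * b 0 powr r + x powr r))"
    if "x > 0" "\<Delta> > 0" "t \<in> {0..T}" "r \<ge> 1" "r \<le> 1 + 2 * B\<^sub>2 / \<sigma>\<^sup>2" for x \<Delta> t r
  proof -
    have "(\<integral>\<^sup>+\<omega>. ennreal (exp_euler c \<sigma> \<alpha> x \<Delta> W t \<omega> powr r) \<partial>M)
      \<le> ennreal (exp ((r - 1 + r * B\<^sub>1) * t) * (t * b 0 powr r + x powr r))"
      using exp_euler_moment[OF c, of \<sigma> B\<^sub>1 r B\<^sub>2 \<alpha> x \<Delta> t] growth that assms c0 by simp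
    also have "\<dots> \<le> ennreal (exp ((r - 1 + r * B\<^sub>1) * T) * (T * b 0 powr r + x powr r))"
    proof (intro ennreal_leI mult_mono add_mono order_refl mult_right_mono)
      have "(r - 1 + r * B\<^sub>1) * t \<le> (r - 1 + r * B\<^sub>1) * T"
        using that assms(7) by (intro mult_left_mono) auto
      then show "exp ((r - 1 + r * B\<^sub>1) * t) \<le> exp ((r - 1 + r * B\<^sub>1) * T)"
        by simp
    qed (use that in simp_all)
    finally show ?thesis .
  qed
  \<comment> \<open>\<open>C\<close> is chosen before \<open>x\<close>, \<open>\<Delta>\<close> and
    \<open>t\<close>, which gives the uniformity claimed.\<close>
  have bound: "\<exists>C\<ge>0. \<forall>x>0. \<forall>\<Delta>>0. \<forall>t\<in>{0..T}.
      (\<integral>\<^sup>+\<omega>. ennreal (exp_euler c \<sigma> \<alpha> x \<Delta> W t \<omega> powr q) \<partial>M) \<le> ennreal (C * (1 + x powr q))"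
  proof (cases "q \<ge> 1")
    case True
    define E where "E = exp ((q - 1 + q * B\<^sub>1) * T)"
    have "E * (T * b 0 powr q + x powr q) \<le> E * (1 + T * b 0 powr q) * (1 + x powr q)" for x
    proof -
      have "T * b 0 powr q + x powr q \<le> (1 + T * b 0 powr q) * (1 + x powr q)"
        using assms(3) by (simp add: algebra_simps)
      then show ?thesis
        unfolding mult.assoc by (intro mult_left_mono) (auto simp: E_def)
    qed
    then have "(\<integral>\<^sup>+\<omega>. ennreal (exp_euler c \<sigma> \<alpha> x \<Delta> W t \<omega> powr q) \<partial>M)
        \<le> ennreal (E * (1 + T * b 0 powr q) * (1 + x powr q))"
      if "x > 0" "\<Delta> > 0" "t \<in> {0..T}" for x \<Delta> t
      using order_trans[OF moment[OF that True q_le] ennreal_leI] by (simp only: E_def)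
    moreover have "E * (1 + T * b 0 powr q) \<ge> 0"
      using assms(3) by (simp add: E_def)
    ultimately show ?thesis
      by blast
  next
    case False
    \<comment> \<open>\<open>D * max 1 x\<close> will bound the first moment. Its
      \<open>q\<close>-th power is at most \<open>D powr q * (1 + x powr q)\<close>, since
      \<open>max 1 x powr q\<close> is the larger of 1 and \<open>x powr q\<close>.\<close>
    define D where "D = exp (B\<^sub>1 * T) * (1 + T * b 0)"
    have "D > 0"
      using assms by (simp add: D_def add_pos_nonneg)
    have "(\<integral>\<^sup>+\<omega>. ennreal (exp_euler c \<sigma> \<alpha> x \<Delta> W t \<omega> powr q) \<partial>M) \<le> ennreal (D powr q * (1 + x powr q))"
      if "x > 0" "\<Delta> > 0" "t \<in> {0..T}" for x \<Delta> t
    proof -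
      have pos: "exp_euler c \<sigma> \<alpha> x \<Delta> W t \<omega> > 0" for \<omega>
        using that assms c0 by (intro exp_euler_pos) auto
      have "T * b 0 * 1 + x \<le> T * b 0 * max 1 x + max 1 x"
        using assms by (intro add_mono mult_left_mono) auto
      then have "exp (B\<^sub>1 * T) * (T * b 0 + x) \<le> D * max 1 x"
        unfolding D_def mult.assoc by (intro mult_left_mono) (auto simp: algebra_simps)
      \<comment> \<open>The exponent 1 is admissible because
        \<open>B\<^sub>2 \<ge> 0\<close>.\<close>
      moreover have "(\<integral>\<^sup>+\<omega>. ennreal (exp_euler c \<sigma> \<alpha> x \<Delta> W t \<omega>) \<partial>M) \<le> ennreal (exp (B\<^sub>1 * T) * (T * b 0 + x))"
        using moment[OF that, of 1] pos assms that by (simp add: less_imp_le)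
      ultimately have "(\<integral>\<^sup>+\<omega>. ennreal (exp_euler c \<sigma> \<alpha> x \<Delta> W t \<omega>) \<partial>M) \<le> ennreal (D * max 1 x)"
        by (meson ennreal_leI order_trans)
      then have "(\<integral>\<^sup>+\<omega>. ennreal (exp_euler c \<sigma> \<alpha> x \<Delta> W t \<omega> powr q) \<partial>M) \<le> ennreal ((D * max 1 x) powr q)"
        using pos \<open>D > 0\<close> \<open>q > 0\<close> False exp_euler_measurable[OF c that(2,3)]
        by (intro nn_integral_powr_le) auto
      also have "\<dots> \<le> ennreal (D powr q * (1 + x powr q))"
      proof (intro ennreal_leI)
        show "(D * max 1 x) powr q \<le> D powr q * (1 + x powr q)"
          using \<open>D > 0\<close> that by (simp add: powr_mult max_def)
      qed
      finally show ?thesis .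
    qed
    then show ?thesis
      by (intro exI[of _ "D powr q"]) simp
  qed
  then obtain C where C: "C \<ge> 0" "\<And>x \<Delta> t. x > 0 \<Longrightarrow> \<Delta> > 0 \<Longrightarrow> t \<in> {0..T} \<Longrightarrow>
      (\<integral>\<^sup>+\<omega>. ennreal (exp_euler c \<sigma> \<alpha> x \<Delta> W t \<omega> powr q) \<partial>M) \<le> ennreal (C * (1 + x powr q))"
    by blast
  \<comment> \<open>Back to the given drift: \<open>c\<close> agrees with \<open>b\<close> on the
    half-line, and the time step is positive.\<close>
  have "exp_euler b \<sigma> \<alpha> x (T / real N) W t \<omega> = exp_euler c \<sigma> \<alpha> x (T / real N) W t \<omega>"
    if "x > 0" "N \<ge> 1" for x N t \<omega>
    using that assms by (intro exp_euler_cong) (auto simp: c_def)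
  then have "(SUP t\<in>{0..T}. \<integral>\<^sup>+\<omega>. ennreal (exp_euler b \<sigma> \<alpha> x (T / real N) W t \<omega> powr (2 * p)) \<partial>M)
      \<le> ennreal (C * (1 + x powr (2 * p)))" if "x > 0" "N \<ge> 1" for x and N :: nat
    using C(2)[unfolded q_def] that assms(3) by (intro SUP_least) simp
  then show ?thesis
    using C(1) by blast
qed

end
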